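(* Let $D\subset\mathbb R^d$ be compact with $\mu(D)>0$, let $\kappa>0$, and let $\nu:D\to\mathbb R$, $\theta^0:D\to\mathbb R$, $\phi:D\times D\to(0,\infty)$. Suppose: (B1) there is a sequence of partitions $\mathcal P^N=\{D^N_\alpha\}_{\alpha=1}^{2^N}$ ($N\ge0$) of $D$ into measurable sets with $\mathcal P^0=\{D^0_1\}=\{D\}$, $\lim_{N\to\infty}\max_{1\le\alpha\le2^N}\mathrm{diam}(D^N_\alpha)=0$, and, for $1\le\alpha\le2^N$, $D^N_\alpha$ is the disjoint union of $D^{N+1}_{2\alpha-1}$ and $D^{N+1}_{2\alpha}$ with $\mu(D^{N+1}_{2\alpha-1})=\mu(D^{N+1}_{2\alpha})$; (B2) $\nu$, $\phi$ and $\theta^0$ are continuous; (B3) there exist $b_\Phi\ge a_\Phi>0$, $-L<a_G<b_G<L$ and $\bar\theta_*\in(0,\pi/2)$ such that $$\mathcal D(\theta^0)\le\bar\theta_*,\quad a_\Phi\le\phi(x,y)\le b_\Phi\ \ \forall x,y\in D,\quad \kappa>\max\Big\{\frac{\mathcal D(\nu)}{a_\Phi\sin\bar\theta_*},\frac{2M_{\mathcal Q^{-1}[F]}}{a_\Phi m_{G'}^2\cos\bar\theta_*}\Big\},$$ $$F(a_G)+\kappa b_\Phi\le\nu(x)\le F(b_G)-\kappa b_\Phi\quad\forall x\in D.$$ Let $\tilde\theta^0:D\to\mathbb R$ be continuous, and assume also that there exist $a_\phi>0$ and $\theta_*\in(0,\pi/2)$ such that $$\phi(x,y)\ge a_\phi\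 \ \forall x,y\in D,\quad 0<\mathcal D(\theta^0),\mathcal D(\tilde\theta^0)<\theta_*,\quad \kappa>\frac{\mathcal D(\nu)}{a_\phi\sin\theta_*},\quad \|\theta^0-\tilde\theta^0\|_\infty<\pi.$$ Let $\theta,\tilde\theta\in C^1([0,\infty);C(D))$ be global classical solutions to the continuum generalized Kuramoto model (with the same $\nu$, $\phi$, $\kappa$) with initial data $\theta^0$ and $\tilde\theta^0$, respectively. Then for all $t\ge0$, $$\|\theta(t,\cdot)-\tilde\theta(t,\cdot)\|_\infty+\int_0^t\mathcal P(s)\,ds\le\|\theta^0-\tilde\theta^0\|_\infty,$$ where $$\mathcal P(s):=\frac{\kappa\,m_{G'}\,a_\phi\sin2\theta_*}{2\theta_*\,\mu(D)}\Big(\mu(D)\|\theta(s,\cdot)-\tilde\theta(s,\cdot)\|_\infty-\|\theta(s,\cdot)-\tilde\theta(s,\cdot)\|_{L^1}\Big)\ge0.$$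
   Context: Let $L\in(0,\infty]$ and let $F:(-L,L)\to\mathbb R$ be a $C^2$ function with $F(-\theta)=-F(\theta)$ and $F'(\theta)>0$ for all $\theta\in(-L,L)$; $G=F^{-1}$. $\mu$ is Lebesgue measure on $\mathbb R^d$. Continuum generalized Kuramoto model: $$F(\partial_t\theta(t,x))=\nu(x)+\frac{\kappa}{\mu(D)}\int_D\phi(x,z)\sin(\theta(t,z)-\theta(t,x))\,d\mu(z),\ t>0,\qquad\theta(0,x)=\theta^0(x).$$ A (global) classical solution is a function $\theta\in C^1([0,\infty);L^\infty(D))$ satisfying the integro-differential equation for all $t\ge0$ and a.e. $x\in D$, and $\theta(0,x)=\theta^0(x)$ for a.e. $x\in D$. Notation: $\|f\|_\infty=\sup_D|f|$, $\|f\|_{L^1}=\int_D|f|\,d\mu$, $\mathcal D(f)=\sup_Df-\inf_Df$ for a function $f$ on $D$; $m_{G'}=\min_{F(a_G)\le y\le F(b_G)}G'(y)$; $M_{\mathcal Q^{-1}[F]}=\max_{(x,y)\in[a_G,b_G]^2}\mathcal Q^{-1}[F](x,y)$, where $\mathcal Q^{-1}[F](x,y)=\frac{x-y}{F(x)-F(y)}$ if $x\ne y$ and $\mathcal Q^{-1}[F](x,x)=\frac1{F'(x)}$. *)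

theory Defs
  imports "HOL-Analysis.Analysis"
begin

definition sym_interval :: "ereal \<Rightarrow> real set" where
  "sym_interval L = {x. - L < ereal x \<and> ereal x < L}"

definition C2_on :: "(real \<Rightarrow> real) \<Rightarrow> real set \<Rightarrow> bool" where
  "C2_on f S \<longleftrightarrow>
     (\<forall>x\<in>S. f field_differentiable at x) \<and>
     (\<forall>x\<in>S. deriv f field_differentiable at x) \<and>
     continuous_on S (deriv (deriv f))"

text \<open>
  The two extremal constants below are written with \<^const>\<open>Inf\<close> and \<^const>\<open>Sup\<close>; for \<open>a < b\<close> in
  \<open>(-L, L)\<close> and \<open>F\<close> of class \<open>C\<^sup>2\<close> with positive derivative, both extrema are attained, so these are
  the minimum and the maximum.
\<close>

definition min_dG :: "ereal \<Rightarrow> (real \<Rightarrow> real) \<Rightarrow> real \<Rightarrow> real \<Rightarrow> real" where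
  "min_dG L F a b = (INF y\<in>{F a..F b}. deriv (the_inv_into (sym_interval L) F) y)"

definition inv_quotient :: "(real \<Rightarrow> real) \<Rightarrow> real \<Rightarrow> real \<Rightarrow> real" where
  "inv_quotient F x y = (if x \<noteq> y then (x - y) / (F x - F y) else 1 / deriv F x)"

definition max_inv_quotient :: "(real \<Rightarrow> real) \<Rightarrow> real \<Rightarrow> real \<Rightarrow> real" where
  "max_inv_quotient F a b = (SUP (x, y)\<in>{a..b} \<times> {a..b}. inv_quotient F x y)"

definition sup_norm :: "'a set \<Rightarrow> ('a \<Rightarrow> real) \<Rightarrow> real" where
  "sup_norm D f = (SUP x\<in>D. \<bar>f x\<bar>)"

definition L1_norm :: "'a::euclidean_space set \<Rightarrow> ('a \<Rightarrow> real) \<Rightarrow> real" where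
  "L1_norm D f = (LINT x:D|lebesgue. \<bar>f x\<bar>)"

definition osc :: "'a set \<Rightarrow> ('a \<Rightarrow> real) \<Rightarrow> real" where
  "osc D f = (SUP x\<in>D. f x) - (INF x\<in>D. f x)"

definition dyadic_partitions :: "'a::euclidean_space set \<Rightarrow> (nat \<Rightarrow> nat \<Rightarrow> 'a set) \<Rightarrow> bool" where
  "dyadic_partitions D P \<longleftrightarrow>
     (\<forall>N. (\<forall>\<alpha>\<in>{1..2 ^ N}. P N \<alpha> \<in> sets lebesgue) \<and>
          disjoint_family_on (P N) {1..2 ^ N} \<and>
          (\<Union>\<alpha>\<in>{1..2 ^ N}. P N \<alpha>) = D) \<and>
     P 0 1 = D \<and>
     (\<lambda>N. MAX \<alpha>\<in>{1..2 ^ N}. diameter (P N \<alpha>)) \<longlonglongrightarrow> 0 \<and>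
     (\<forall>N. \<forall>\<alpha>\<in>{1..2 ^ N}.
        P N \<alpha> = P (Suc N) (2 * \<alpha> - 1) \<union> P (Suc N) (2 * \<alpha>) \<and>
        P (Suc N) (2 * \<alpha> - 1) \<inter> P (Suc N) (2 * \<alpha>) = {} \<and>
        measure lebesgue (P (Suc N) (2 * \<alpha> - 1)) = measure lebesgue (P (Suc N) (2 * \<alpha>)))"

text \<open>
  \<open>\<theta> \<in> C\<^sup>1([0,\<infty>); C(D))\<close> with derivative \<open>\<theta>'\<close>: differentiability and continuity of the derivative are
  taken in the Banach space \<open>C(D)\<close> with the supremum norm (\<open>D\<close> compact and nonempty), one-sided at
  \<open>t = 0\<close>. Elements of \<open>C(D)\<close> are represented by total functions whose values off \<open>D\<close> are irrelevant.
\<close>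

definition C1_into_CD ::
    "'a::euclidean_space set \<Rightarrow> (real \<Rightarrow> 'a \<Rightarrow> real) \<Rightarrow> (real \<Rightarrow> 'a \<Rightarrow> real) \<Rightarrow> bool" where
  "C1_into_CD D \<theta> \<theta>' \<longleftrightarrow>
     (\<forall>t\<ge>0. continuous_on D (\<theta> t) \<and> continuous_on D (\<theta>' t)) \<and>
     (\<forall>t\<ge>0. ((\<lambda>s. sup_norm D (\<lambda>x. (\<theta> s x - \<theta> t x) / (s - t) - \<theta>' t x)) \<longlongrightarrow> 0) (at t within {0..})) \<and>
     (\<forall>t\<ge>0. ((\<lambda>s. sup_norm D (\<lambda>x. \<theta>' s x - \<theta>' t x)) \<longlongrightarrow> 0) (at t within {0..}))"

text \<open>
  Global classical solutions of regularity \<open>C\<^sup>1([0,\<infty>); C(D))\<close>, a subspace of \<open>C\<^sup>1([0,\<infty>); L\<^sup>\<infinity>(D))\<close> on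
  which the two time derivatives agree. Since \<open>F\<close> is only given on \<open>(-L, L)\<close>, satisfying the equation
  includes that the velocity takes values there.
\<close>

definition classical_solution_CD ::
    "ereal \<Rightarrow> (real \<Rightarrow> real) \<Rightarrow> 'a::euclidean_space set \<Rightarrow> ('a \<Rightarrow> real) \<Rightarrow> real \<Rightarrow> ('a \<Rightarrow> 'a \<Rightarrow> real) \<Rightarrow>
     ('a \<Rightarrow> real) \<Rightarrow> (real \<Rightarrow> 'a \<Rightarrow> real) \<Rightarrow> bool" where
  "classical_solution_CD L F D \<nu> \<kappa> \<phi> \<theta>0 \<theta> \<longleftrightarrow>
     (\<exists>\<theta>'. C1_into_CD D \<theta> \<theta>' \<and>
        (\<forall>t\<ge>0. AE x in lebesgue. x \<in> D \<longrightarrow>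
           \<theta>' t x \<in> sym_interval L \<and>
           F (\<theta>' t x) =
             \<nu> x + \<kappa> / measure lebesgue D * (LINT z:D|lebesgue. \<phi> x z * sin (\<theta> t z - \<theta> t x)))) \<and>
     (AE x in lebesgue. x \<in> D \<longrightarrow> \<theta> 0 x = \<theta>0 x)"

definition dissipation ::
    "ereal \<Rightarrow> (real \<Rightarrow> real) \<Rightarrow> real \<Rightarrow> real \<Rightarrow> 'a::euclidean_space set \<Rightarrow> real \<Rightarrow> real \<Rightarrow> real \<Rightarrow>
     (real \<Rightarrow> 'a \<Rightarrow> real) \<Rightarrow> (real \<Rightarrow> 'a \<Rightarrow> real) \<Rightarrow> real \<Rightarrow> real" where
  "dissipation L F aG bG D \<kappa> a\<phi> \<theta>s \<theta> \<eta> s =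
     \<kappa> * min_dG L F aG bG * a\<phi> * sin (2 * \<theta>s) / (2 * \<theta>s * measure lebesgue D) *
     (measure lebesgue D * sup_norm D (\<lambda>x. \<theta> s x - \<eta> s x) - L1_norm D (\<lambda>x. \<theta> s x - \<eta> s x))"

end

theory Submission
  imports Defs
begin

text \<open>The two phase profiles are compared where they are furthest apart. Let \<open>w = \<theta> - \<eta>\<close> and let \<open>x\<close> be
  a point at which \<open>w t\<close> attains \<open>\<parallel>w t\<parallel>\<^sub>\<infinity>\<close> (if instead \<open>-w t\<close> attains it, exchange \<open>\<theta>\<close> and \<open>\<eta>\<close>).
  Subtracting the two equations at \<open>x\<close>, the frequencies \<open>\<nu> x\<close> cancel and what remains is an average of
  \<open>\<phi> x z (sin (\<theta> z - \<theta> x) - sin (\<eta> z - \<eta> x))\<close>. The difference of the two angles is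
  \<open>w z - w x \<le> 0\<close>, and both angles lie in \<open>[-\<theta>\<^sub>*, \<theta>\<^sub>*]\<close> with \<open>\<theta>\<^sub>* < \<pi>/2\<close>, where a chord of the
  sine has slope at least \<open>sin (2 \<theta>\<^sub>*) / (2 \<theta>\<^sub>*)\<close> (lemma \<open>sin_diff_le_secant\<close>). Since
  \<open>w z - w x \<le> \<bar>w z\<bar> - \<parallel>w\<parallel>\<^sub>\<infinity>\<close>, the average is at most a negative multiple of
  \<open>\<mu>(D) \<parallel>w\<parallel>\<^sub>\<infinity> - \<parallel>w\<parallel>\<^sub>L\<^sub>1\<close>; applying \<open>F\<^sup>-\<^sup>1\<close>, whose slope is at least \<open>m\<^sub>G\<^sub>'\<close>, shows that
  \<open>w\<close> decreases at \<open>x\<close> with speed at least the dissipation (lemma \<open>extremal_contraction\<close>).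

  The angles stay within \<open>\<theta>\<^sub>*\<close> for the same kind of reason: if the oscillation of \<open>\<theta> t\<close> were to reach
  \<open>\<theta>\<^sub>*\<close>, the pull of the bulk on the two extremal points would exceed the spread of the
  frequencies, so these points would be approaching each other (lemma \<open>phase_cohesion\<close>).

  Both arguments turn a sign condition on the velocity at extremal points into a bound for all times.
  The maximum need not be differentiable in \<open>t\<close>, so this is done by looking at the first time at which
  some point touches a moving barrier (lemma \<open>barrier\<close>). It requires the equation at every point, while
  a classical solution satisfies it only almost everywhere; the dyadic partitions close this
  gap, because they force every nonempty relatively open part of \<open>D\<close> to have positive measure.\<close>

section \<open>Suprema and integrals over a compact set\<close>

lemma abs_le_sup_norm:
  assumes "compact D" "continuous_on D f" "x \<in> D"
  shows "\<bar>f x\<bar> \<le> sup_norm D f"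
  unfolding sup_norm_def
  by (intro cSUP_upper assms compact_imp_bounded[THEN bounded_imp_bdd_above]
      compact_continuous_image continuous_on_rabs)

lemma sup_norm_le:
  assumes "D \<noteq> {}" "\<And>x. x \<in> D \<Longrightarrow> \<bar>f x\<bar> \<le> c"
  shows "sup_norm D f \<le> c"
  unfolding sup_norm_def by (intro cSUP_least assms)

lemma diff_le_osc:
  assumes D: "compact D" "continuous_on D f" and "x \<in> D" "y \<in> D"
  shows "f x - f y \<le> osc D f"
proof -
  have "bounded (f ` D)"
    using D by (intro compact_imp_bounded compact_continuous_image)
  then have "f x \<le> (SUP x\<in>D. f x)" "(INF x\<in>D. f x) \<le> f y"
    using assms by (auto intro!: cSUP_upper cINF_lower bounded_imp_bdd_above bounded_imp_bdd_below)
  then show ?thesis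
    unfolding osc_def by linarith
qed

lemma set_integrable_compact:
  fixes f :: "'a::euclidean_space \<Rightarrow> real"
  assumes "compact D" "continuous_on D f"
  shows "set_integrable lebesgue D f"
  using borel_integrable_compact[OF assms] unfolding set_integrable_def
  by (simp add: integrable_completion borel_measurable_integrable)

lemma set_integral_const_compact:
  fixes D :: "'a::euclidean_space set"
  assumes "compact D"
  shows "(LINT x:D|lebesgue. (c::real)) = c * measure lebesgue D"
  using lmeasurable_compact[OF assms] unfolding set_lebesgue_integral_def fmeasurable_def
  by (simp add: mult.commute)

lemma abs_set_integral_le:
  fixes f :: "'a::euclidean_space \<Rightarrow> real"
  assumes D: "compact D" and f: "continuous_on D f" "\<And>x. x \<in> D \<Longrightarrow> \<bar>f x\<bar> \<le> c"
  shows "\<bar>LINT x:D|lebesgue. f x\<bar> \<le> c * measure lebesgue D"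
proof -
  have "(LINT x:D|lebesgue. f x) \<le> (LINT x:D|lebesgue. c)"
       "(LINT x:D|lebesgue. - c) \<le> (LINT x:D|lebesgue. f x)"
    using f by (intro set_integral_mono set_integrable_compact D continuous_intros; force)+
  then show ?thesis
    unfolding set_integral_const_compact[OF D] by linarith
qed

lemma ex_mult_less:
  fixes m e :: real
  assumes "0 \<le> m" "0 < e"
  shows "\<exists>c>0. c * m < e"
  using assms by (intro exI[of _ "e / (m + 1)"]) (simp add: field_simps)

text \<open>The kernel is uniformly continuous on the compact product, so its sections depend uniformly
  on the parameter.\<close>

lemma continuous_on_parametric_integral:
  fixes k :: "'a::euclidean_space \<Rightarrow> 'a \<Rightarrow> real"
  assumes D: "compact D" and k: "continuous_on (D \<times> D) (\<lambda>(x, z). k x z)"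
  shows "continuous_on D (\<lambda>x. LINT z:D|lebesgue. k x z)"
  unfolding continuous_on_iff
proof (intro ballI allI impI)
  fix x :: 'a and e :: real
  assume x: "x \<in> D" and e: "0 < e"
  obtain c where c: "0 < c" "c * measure lebesgue D < e"
    using ex_mult_less[OF measure_nonneg e] by blast
  have "uniformly_continuous_on (D \<times> D) (\<lambda>(x, z). k x z)"
    using k D by (intro compact_uniformly_continuous compact_Times)
  then obtain d where d: "d > 0"
    and close: "\<And>p q. p \<in> D \<times> D \<Longrightarrow> q \<in> D \<times> D \<Longrightarrow> dist q p < d \<Longrightarrow>
      dist (case q of (x, z) \<Rightarrow> k x z) (case p of (x, z) \<Rightarrow> k x z) < c"
    using c(1) unfolding uniformly_continuous_on_def by meson
  have slice: "continuous_on D (k y)" if "y \<in> D" for y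
    using continuous_on_compose2[OF k, of D "\<lambda>z. (y, z)"] that
    by (force intro!: continuous_intros)
  have "dist (LINT z:D|lebesgue. k y z) (LINT z:D|lebesgue. k x z) < e"
    if y: "y \<in> D" "dist y x < d" for y
  proof -
    have "\<bar>LINT z:D|lebesgue. k y z - k x z\<bar> \<le> c * measure lebesgue D"
    proof (rule abs_set_integral_le[OF D])
      show "continuous_on D (\<lambda>z. k y z - k x z)"
        by (intro continuous_intros slice x y)
      show "\<bar>k y z - k x z\<bar> \<le> c" if "z \<in> D" for z
        using close[of "(x, z)" "(y, z)"] x y that by (simp add: dist_Pair_Pair dist_real_def)
    qed
    also have "\<dots> < e"
      by (rule c)
    finally show ?thesis
      using x y D slice by (simp add: dist_real_def set_integral_diff set_integrable_compact)
  qed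
  then show "\<exists>d>0. \<forall>y\<in>D. dist y x < d \<longrightarrow>
      dist (LINT z:D|lebesgue. k y z) (LINT z:D|lebesgue. k x z) < e"
    using d by blast
qed

lemma tendsto_sup_norm:
  fixes f :: "real \<Rightarrow> 'a::topological_space \<Rightarrow> real"
  assumes D: "compact D" "D \<noteq> {}" and f: "\<forall>\<^sub>F s in net. continuous_on D (f s)"
    and g: "continuous_on D g" and lim: "uniform_limit D f g net"
  shows "((\<lambda>s. sup_norm D (f s)) \<longlongrightarrow> sup_norm D g) net"
proof (rule tendstoI)
  fix e :: real
  assume "0 < e"
  then have "\<forall>\<^sub>F s in net. \<forall>x\<in>D. dist (f s x) (g x) < e / 2"
    using lim by (intro uniform_limitD) auto
  with f show "\<forall>\<^sub>F s in net. dist (sup_norm D (f s)) (sup_norm D g) < e"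
  proof eventually_elim
    case (elim s)
    have near: "\<bar>f s x - g x\<bar> \<le> e / 2" if "x \<in> D" for x
      using elim(2) that by (force simp: dist_real_def)
    have "sup_norm D (f s) \<le> sup_norm D g + e / 2"
    proof (rule sup_norm_le[OF D(2)])
      show "\<bar>f s x\<bar> \<le> sup_norm D g + e / 2" if "x \<in> D" for x
        using near[OF that] abs_le_sup_norm[OF D(1) g that] by linarith
    qed
    moreover have "sup_norm D g \<le> sup_norm D (f s) + e / 2"
    proof (rule sup_norm_le[OF D(2)])
      show "\<bar>g x\<bar> \<le> sup_norm D (f s) + e / 2" if "x \<in> D" for x
        using near[OF that] abs_le_sup_norm[OF D(1) elim(1) that] by linarith
    qed
    ultimately show ?case
      using \<open>0 < e\<close> by (simp add: dist_real_def)
  qed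
qed

lemma tendsto_L1_norm:
  fixes f :: "real \<Rightarrow> 'a::euclidean_space \<Rightarrow> real"
  assumes D: "compact D" and f: "\<forall>\<^sub>F s in net. continuous_on D (f s)"
    and g: "continuous_on D g" and lim: "uniform_limit D f g net"
  shows "((\<lambda>s. L1_norm D (f s)) \<longlongrightarrow> L1_norm D g) net"
proof (rule tendstoI)
  fix e :: real
  assume e: "0 < e"
  obtain c where c: "0 < c" "c * measure lebesgue D < e"
    using ex_mult_less[OF measure_nonneg e] by blast
  then have "\<forall>\<^sub>F s in net. \<forall>x\<in>D. dist (f s x) (g x) < c"
    using lim by (intro uniform_limitD) auto
  with f show "\<forall>\<^sub>F s in net. dist (L1_norm D (f s)) (L1_norm D g) < e"
  proof eventually_elim
    case (elim s)
    have "\<bar>LINT x:D|lebesgue. \<bar>f s x\<bar> - \<bar>g x\<bar>\<bar> \<le> c * measure lebesgue D"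
      using elim g by (intro abs_set_integral_le D continuous_intros) (force simp: dist_real_def)+
    also have "\<dots> < e"
      by (rule c)
    finally show ?case
      using D g elim(1)
      by (simp add: L1_norm_def dist_real_def set_integral_diff set_integrable_compact
          continuous_on_rabs)
  qed
qed

section \<open>Dyadic partitions give the measure full support\<close>

lemma measure_dyadic_cell:
  assumes D: "compact D" and P: "dyadic_partitions D P" and \<alpha>: "\<alpha> \<in> {1..2 ^ N}"
  shows "measure lebesgue (P N \<alpha>) = measure lebesgue D / 2 ^ N"
  using \<alpha>
proof (induction N arbitrary: \<alpha>)
  case 0
  moreover have "P 0 1 = D"
    using P unfolding dyadic_partitions_def by blast
  ultimately show ?case
    by simp
next
  case (Suc N)
  have fm: "P M \<beta> \<in> lmeasurable" if "\<beta> \<in> {1..2 ^ M}" for M \<beta>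
  proof (rule fmeasurableI2[OF lmeasurable_compact[OF D]])
    show "P M \<beta> \<subseteq> D" "P M \<beta> \<in> sets lebesgue"
      using P that unfolding dyadic_partitions_def by blast+
  qed
  \<comment> \<open>the index of the parent cell\<close>
  define \<beta> where "\<beta> = (\<alpha> + 1) div 2"
  have \<beta>: "\<beta> \<in> {1..2 ^ N}" and \<alpha>: "\<alpha> = 2 * \<beta> - 1 \<or> \<alpha> = 2 * \<beta>"
    using Suc.prems unfolding \<beta>_def by auto
  have split: "P N \<beta> = P (Suc N) (2 * \<beta> - 1) \<union> P (Suc N) (2 * \<beta>)"
    "P (Suc N) (2 * \<beta> - 1) \<inter> P (Suc N) (2 * \<beta>) = {}"
    "measure lebesgue (P (Suc N) (2 * \<beta> - 1)) = measure lebesgue (P (Suc N) (2 * \<beta>))"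
    using P \<beta> unfolding dyadic_partitions_def by blast+
  have "measure lebesgue (P N \<beta>)
      = measure lebesgue (P (Suc N) (2 * \<beta> - 1)) + measure lebesgue (P (Suc N) (2 * \<beta>))"
    unfolding split(1) using \<beta> split(2) by (intro measure_Un_AE AE_I2) (auto intro!: fm)
  with Suc.IH[OF \<beta>] split(3) \<alpha> show ?case
    by auto
qed

text \<open>The cell of a sufficiently fine partition that contains \<open>x\<close> lies within the ball, and it
  carries its full share of the measure of \<open>D\<close>.\<close>

lemma dyadic_ball_not_null:
  fixes D :: "'a::euclidean_space set"
  assumes D: "compact D" "0 < measure lebesgue D" and P: "dyadic_partitions D P"
    and x: "x \<in> D" and e: "0 < e"
  shows "D \<inter> ball x e \<notin> null_sets lebesgue"
proof
  assume null: "D \<inter> ball x e \<in> null_sets lebesgue"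
  have "(\<lambda>N. MAX \<alpha>\<in>{1..2 ^ N}. diameter (P N \<alpha>)) \<longlonglongrightarrow> 0"
    using P unfolding dyadic_partitions_def by blast
  then have "\<forall>\<^sub>F N in sequentially. (MAX \<alpha>\<in>{1..2 ^ N}. diameter (P N \<alpha>)) < e"
    using e by (rule order_tendstoD)
  then obtain N where N: "(MAX \<alpha>\<in>{1..2 ^ N}. diameter (P N \<alpha>)) < e"
    using eventually_happens'[OF sequentially_bot] by blast
  have union: "(\<Union>\<alpha>\<in>{1..2 ^ N}. P N \<alpha>) = D"
    using P unfolding dyadic_partitions_def by blast
  then obtain \<alpha> where \<alpha>: "\<alpha> \<in> {1..2 ^ N}" "x \<in> P N \<alpha>"
    using x by blast
  have sub: "P N \<alpha> \<subseteq> D"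
    using union \<alpha> by blast
  have "diameter (P N \<alpha>) < e"
    using N \<alpha>(1) by (subst (asm) Max_less_iff) auto
  then have "P N \<alpha> \<subseteq> D \<inter> ball x e"
    using diameter_bounded_bound[of "P N \<alpha>" x] \<alpha>(2) sub
      bounded_subset[OF compact_imp_bounded[OF D(1)] sub] by fastforce
  moreover have "P N \<alpha> \<in> sets lebesgue"
    using P \<alpha>(1) unfolding dyadic_partitions_def by blast
  ultimately have "P N \<alpha> \<in> null_sets lebesgue"
    using null null_sets_subset by blast
  then have "measure lebesgue (P N \<alpha>) = 0"
    by (simp add: measure_eq_0_null_sets)
  with measure_dyadic_cell[OF D(1) P \<alpha>(1)] D(2) show False
    by simp
qed

text \<open>The exceptional null set contains no relative neighbourhood of any point of \<open>D\<close>, hence its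
  complement is dense in \<open>D\<close> and closed conditions on a continuous function extend by continuity.\<close>

lemma AE_closed_imp_all:
  fixes f :: "'a::euclidean_space \<Rightarrow> real"
  assumes supp: "\<And>x e. x \<in> D \<Longrightarrow> 0 < e \<Longrightarrow> D \<inter> ball x e \<notin> null_sets lebesgue"
    and f: "continuous_on D f" and C: "closed C"
    and ae: "AE x in lebesgue. x \<in> D \<longrightarrow> f x \<in> C" and x: "x \<in> D"
  shows "f x \<in> C"
proof (rule ccontr)
  assume "f x \<notin> C"
  then obtain U where "open U" "x \<in> U" and U: "\<And>y. y \<in> D \<Longrightarrow> y \<in> U \<Longrightarrow> f y \<in> - C"
    using f C x unfolding continuous_on_topological by (metis ComplI open_Compl)
  then obtain e where e: "0 < e" "ball x e \<subseteq> U"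
    using open_contains_ball by blast
  obtain N where "N \<in> null_sets lebesgue" "{y. \<not> (y \<in> D \<longrightarrow> f y \<in> C)} \<subseteq> N"
    using ae unfolding eventually_ae_filter by auto
  moreover have "D \<inter> ball x e \<subseteq> {y. \<not> (y \<in> D \<longrightarrow> f y \<in> C)}"
    using U e by auto
  ultimately have "D \<inter> ball x e \<in> null_sets lebesgue"
    by (meson null_sets_completion_subset subset_trans)
  then show False
    using supp[OF x e(1)] by blast
qed

section \<open>A barrier principle\<close>

text \<open>At the first time \<open>\<tau>\<close> at which some point reaches the level \<open>0\<close>, all points are still at or below that
  level, so \<open>touch\<close> applies and says that the point is moving down. But then it was above \<open>0\<close>
  shortly before \<open>\<tau>\<close>. Compactness of \<open>K\<close> is what makes a first time exist. The hypothesis \<open>touch\<close> is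
  restricted to points that maximize \<open>v t\<close>, which is where differential information about a maximum
  over \<open>K\<close> is available.\<close>

lemma barrier:
  fixes v v' :: "real \<Rightarrow> 'b::metric_space \<Rightarrow> real"
  assumes K: "compact K"
    and cont: "continuous_on ({0..} \<times> K) (\<lambda>(t, x). v t x)"
    and deriv: "\<And>t x. 0 \<le> t \<Longrightarrow> x \<in> K \<Longrightarrow>
      ((\<lambda>s. v s x) has_real_derivative v' t x) (at t within {0..})"
    and init: "\<And>x. x \<in> K \<Longrightarrow> v 0 x < 0"
    and touch: "\<And>t x. 0 < t \<Longrightarrow> x \<in> K \<Longrightarrow> v t x = 0 \<Longrightarrow> (\<And>y. y \<in> K \<Longrightarrow> v t y \<le> 0) \<Longrightarrow>
      v' t x < 0"
    and t: "0 \<le> t" and x: "x \<in> K"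
  shows "v t x < 0"
proof (rule ccontr)
  assume "\<not> v t x < 0"
  define Z where "Z = ({0..t} \<times> K) \<inter> (\<lambda>(t, x). v t x) -` {0..}"
  have box: "compact ({0..t} \<times> K)"
    by (intro compact_Times K compact_Icc)
  then have "closed Z"
    unfolding Z_def
    by (intro continuous_closed_preimage continuous_on_subset[OF cont]
        compact_imp_closed[OF box] closed_atLeast) auto
  then have "compact Z"
    using compact_Int_closed[OF box] by (metis Int_lower1 Z_def inf.absorb_iff2)
  then have "compact (fst ` Z)"
    by (intro compact_continuous_image continuous_intros)
  moreover have "(t, x) \<in> Z"
    using t x \<open>\<not> v t x < 0\<close> by (simp add: Z_def)
  ultimately obtain \<tau> where \<tau>: "\<tau> \<in> fst ` Z" and first: "\<And>s. s \<in> fst ` Z \<Longrightarrow> \<tau> \<le> s"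
    using compact_attains_inf[of "fst ` Z"] by blast
  then obtain y where y: "y \<in> K" "0 \<le> v \<tau> y" "0 \<le> \<tau>" "\<tau> \<le> t"
    by (auto simp: Z_def)
  have before: "v s z < 0" if "0 \<le> s" "s < \<tau>" "z \<in> K" for s z
    using first[of s] that y(4) by (force simp: Z_def image_iff)
  have "0 < \<tau>"
    using init[OF y(1)] y by (cases "\<tau> = 0") auto
  have at_\<tau>: "v \<tau> z \<le> 0" if z: "z \<in> K" for z
  proof (rule ccontr)
    assume "\<not> v \<tau> z \<le> 0"
    moreover have "continuous_on {0..\<tau>} (\<lambda>s. v s z)"
      using continuous_on_compose2[OF cont, of "{0..\<tau>}" "\<lambda>s. (s, z)"] z
      by (force intro!: continuous_intros)
    ultimately obtain s where "0 \<le> s" "s \<le> \<tau>" "v s z = 0"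
      using IVT'[of "\<lambda>s. v s z" 0 0 \<tau>] init[OF z] y(3) by auto
    with before[of s z] z \<open>\<not> v \<tau> z \<le> 0\<close> show False
      by (cases "s = \<tau>") auto
  qed
  have "v' \<tau> y < 0"
    using touch[OF \<open>0 < \<tau>\<close> y(1)] at_\<tau> y by force
  from has_real_derivative_neg_dec_left[OF deriv[OF y(3,1)] this]
  obtain d where d: "0 < d" "\<And>h. 0 < h \<Longrightarrow> \<tau> - h \<in> {0..} \<Longrightarrow> h < d \<Longrightarrow> v \<tau> y < v (\<tau> - h) y"
    by blast
  \<comment> \<open>a step back from \<open>\<tau>\<close> that does not leave the time interval\<close>
  define h where "h = min \<tau> (d / 2)"
  have "0 < h" "\<tau> - h \<in> {0..}" "h < d"
    using d \<open>0 < \<tau>\<close> by (auto simp: h_def)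
  with d(2)[of h] before[of "\<tau> - h" y] y show False
    by auto
qed

section \<open>Curves in the space of continuous functions\<close>

lemma C1_into_CD_has_derivative:
  assumes D: "compact D" and C1: "C1_into_CD D \<theta> \<theta>'" and t: "0 \<le> t" and x: "x \<in> D"
  shows "((\<lambda>s. \<theta> s x) has_real_derivative \<theta>' t x) (at t within {0..})"
proof -
  have lim: "((\<lambda>s. sup_norm D (\<lambda>x. (\<theta> s x - \<theta> t x) / (s - t) - \<theta>' t x)) \<longlongrightarrow> 0)
      (at t within {0..})"
    using C1 t by (simp add: C1_into_CD_def)
  have "\<forall>\<^sub>F s in at t within {0..}. norm ((\<theta> s x - \<theta> t x) / (s - t) - \<theta>' t x)
      \<le> sup_norm D (\<lambda>x. (\<theta> s x - \<theta> t x) / (s - t) - \<theta>' t x)"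
    unfolding eventually_at_filter
  proof (rule always_eventually, intro allI impI)
    fix s assume "s \<noteq> t" "s \<in> {0..}"
    then have "continuous_on D (\<lambda>x. (\<theta> s x - \<theta> t x) / (s - t) - \<theta>' t x)"
      using C1 t unfolding C1_into_CD_def by (intro continuous_intros) auto
    from abs_le_sup_norm[OF D this x]
    show "norm ((\<theta> s x - \<theta> t x) / (s - t) - \<theta>' t x)
      \<le> sup_norm D (\<lambda>x. (\<theta> s x - \<theta> t x) / (s - t) - \<theta>' t x)"
      by simp
  qed
  from Lim_null_comparison[OF this lim] show ?thesis
    unfolding has_field_derivative_iff by (rule LIM_zero_cancel)
qed

text \<open>The difference quotients are bounded in the supremum norm near \<open>t\<close>.\<close>

lemma C1_into_CD_uniform_limit:
  assumes D: "compact D" and C1: "C1_into_CD D \<theta> \<theta>'" and t: "0 \<le> t"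
  shows "uniform_limit D \<theta> (\<theta> t) (at t within {0..})"
proof (rule uniform_limitI)
  fix e :: real
  assume "0 < e"
  define M where "M = \<bar>sup_norm D (\<theta>' t)\<bar> + 1"
  have "0 < M" by (simp add: M_def)
  let ?q = "\<lambda>s x. (\<theta> s x - \<theta> t x) / (s - t) - \<theta>' t x"
  have "\<forall>\<^sub>F s in at t within {0..}. sup_norm D (?q s) < 1"
    using C1 t unfolding C1_into_CD_def by (intro order_tendstoD) auto
  moreover have "\<forall>\<^sub>F s in at t within {0..}. dist s t < e / M"
    using \<open>0 < e\<close> \<open>0 < M\<close> tendsto_ident_at[of t "{0..}"] by (intro tendstoD) auto
  moreover have "\<forall>\<^sub>F s in at t within {0..}. s \<noteq> t \<and> s \<in> {0..}"
    by (simp add: eventually_at_filter)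
  ultimately show "\<forall>\<^sub>F s in at t within {0..}. \<forall>x\<in>D. dist (\<theta> s x) (\<theta> t x) < e"
  proof eventually_elim
    case (elim s)
    show ?case
    proof
      fix x assume x: "x \<in> D"
      have c: "continuous_on D (?q s)" "continuous_on D (\<theta>' t)"
        using C1 t elim(3) unfolding C1_into_CD_def by (auto intro!: continuous_intros)
      have "\<bar>?q s x\<bar> < 1" "\<bar>\<theta>' t x\<bar> \<le> sup_norm D (\<theta>' t)"
        using abs_le_sup_norm[OF D c(1) x] elim(1) abs_le_sup_norm[OF D c(2) x] by linarith+
      then have "\<bar>(\<theta> s x - \<theta> t x) / (s - t)\<bar> \<le> M"
        unfolding M_def by linarith
      then have "\<bar>\<theta> s x - \<theta> t x\<bar> \<le> M * \<bar>s - t\<bar>"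
        using elim(3) by (simp add: abs_divide divide_le_eq)
      also have "\<dots> < e"
        using elim(2) \<open>0 < M\<close> by (simp add: dist_real_def field_simps)
      finally show "dist (\<theta> s x) (\<theta> t x) < e"
        by (simp add: dist_real_def)
    qed
  qed
qed

lemma continuous_on_Times_uniform_limit:
  fixes f :: "'a::metric_space \<Rightarrow> 'b::metric_space \<Rightarrow> 'c::metric_space"
  assumes cont: "\<And>t. t \<in> T \<Longrightarrow> continuous_on D (f t)"
    and lim: "\<And>t. t \<in> T \<Longrightarrow> uniform_limit D f (f t) (at t within T)"
  shows "continuous_on (T \<times> D) (\<lambda>(t, x). f t x)"
  unfolding continuous_on_iff
proof (intro ballI allI impI)
  fix p and e :: real
  assume "p \<in> T \<times> D" and "0 < e"
  then obtain t x where p: "p = (t, x)" "t \<in> T" "x \<in> D"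
    by blast
  have "\<forall>\<^sub>F s in at t within T. \<forall>y\<in>D. dist (f s y) (f t y) < e / 2"
    using \<open>0 < e\<close> by (intro uniform_limitD lim p) auto
  then obtain d where d: "0 < d"
    "\<And>s y. s \<in> T \<Longrightarrow> s \<noteq> t \<Longrightarrow> dist s t < d \<Longrightarrow> y \<in> D \<Longrightarrow> dist (f s y) (f t y) < e / 2"
    unfolding eventually_at by blast
  obtain d' where d': "0 < d'" "\<And>y. y \<in> D \<Longrightarrow> dist y x < d' \<Longrightarrow> dist (f t y) (f t x) < e / 2"
    using cont[OF p(2)] p(3) \<open>0 < e\<close> unfolding continuous_on_iff by (meson half_gt_zero)
  have "dist (f s y) (f t x) < e"
    if sy: "s \<in> T" "y \<in> D" "dist (s, y) (t, x) < min d d'" for s y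
  proof -
    have "dist s t < d" "dist y x < d'"
      using sy(3) dist_fst_le[of "(s, y)" "(t, x)"] dist_snd_le[of "(s, y)" "(t, x)"] by auto
    then have "dist (f s y) (f t y) < e / 2" "dist (f t y) (f t x) < e / 2"
      using d(2)[of s y] d'(2)[of y] sy \<open>0 < e\<close> by (cases "s = t"; auto)+
    then show ?thesis
      using dist_triangle[of "f s y" "f t x" "f t y"] by linarith
  qed
  then show "\<exists>d>0. \<forall>q\<in>T \<times> D. dist q p < d \<longrightarrow>
      dist (case q of (t, x) \<Rightarrow> f t x) (case p of (t, x) \<Rightarrow> f t x) < e"
    using d d' p by (intro exI[of _ "min d d'"]) auto
qed

lemma C1_into_CD_jointly_continuous:
  assumes "compact D" "C1_into_CD D \<theta> \<theta>'"
  shows "continuous_on ({0..} \<times> D) (\<lambda>(t, x). \<theta> t x)"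
  using assms C1_into_CD_uniform_limit[OF assms]
  by (intro continuous_on_Times_uniform_limit) (auto simp: C1_into_CD_def)

section \<open>Estimates for the sine\<close>

lemma mult_sin_le_sin_mult:
  assumes "0 \<le> r" "r \<le> 1" "0 \<le> x" "x \<le> pi"
  shows "r * sin x \<le> sin (r * x)"
proof -
  have "convex_on {0..pi} (\<lambda>x. - sin x)"
    by (rule f''_ge0_imp_convex[where f' = "\<lambda>x. - cos x" and f'' = sin])
      (auto intro!: derivative_eq_intros sin_ge_zero)
  from convex_onD[OF this, of r 0 x] show ?thesis
    using assms by simp
qed

text \<open>By the sum-to-product formula \<open>sin B - sin A = 2 sin u cos ((A + B) / 2)\<close> with \<open>u = (B - A) / 2\<close>.
  Concavity bounds \<open>sin u\<close> below by \<open>(u / \<alpha>) sin \<alpha>\<close>, the cosine is at least \<open>cos \<alpha>\<close>, and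
  \<open>2 sin \<alpha> cos \<alpha> = sin (2 \<alpha>)\<close>.\<close>

lemma sin_diff_le_secant:
  fixes \<alpha> A B :: real
  assumes \<alpha>: "0 < \<alpha>" "\<alpha> < pi / 2" and "\<bar>A\<bar> \<le> \<alpha>" "\<bar>B\<bar> \<le> \<alpha>" "A \<le> B"
  shows "sin A - sin B \<le> sin (2 * \<alpha>) / (2 * \<alpha>) * (A - B)"
proof -
  define u where "u = (B - A) / 2"
  have u: "0 \<le> u" "u \<le> \<alpha>"
    using assms unfolding u_def by auto
  have "u / \<alpha> * sin \<alpha> \<le> sin (u / \<alpha> * \<alpha>)"
    using \<alpha> u by (intro mult_sin_le_sin_mult) auto
  then have su: "u / \<alpha> * sin \<alpha> \<le> sin u"
    using \<alpha> by simp
  have "\<bar>(B + A) / 2\<bar> \<le> \<alpha>"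
    using assms by auto
  then have "cos \<alpha> \<le> cos \<bar>(B + A) / 2\<bar>"
    using \<alpha> by (intro cos_monotone_0_pi_le) auto
  then have cu: "cos \<alpha> \<le> cos ((B + A) / 2)"
    unfolding cos_abs_real .
  have "sin (2 * \<alpha>) / (2 * \<alpha>) * (B - A) = 2 * (u / \<alpha> * sin \<alpha> * cos \<alpha>)"
    using \<alpha> unfolding u_def sin_double by (simp add: field_simps)
  also have "\<dots> \<le> 2 * (sin u * cos ((B + A) / 2))"
    using su cu u \<alpha>
    by (intro mult_left_mono mult_mono order_trans[OF _ su])
      (auto intro!: cos_ge_zero sin_ge_zero mult_nonneg_nonneg divide_nonneg_pos)
  also have "\<dots> = sin B - sin A"
    unfolding sin_diff_sin u_def by simp
  finally show ?thesis
    unfolding right_diff_distrib by linarith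
qed

section \<open>The velocity law\<close>

lemma open_sym_interval: "open (sym_interval L)"
  unfolding sym_interval_def by (intro open_Collect_conj open_Collect_less continuous_intros)

lemma atLeastAtMost_subset_sym_interval:
  assumes "x \<in> sym_interval L" "y \<in> sym_interval L"
  shows "{x..y} \<subseteq> sym_interval L"
proof
  fix z assume "z \<in> {x..y}"
  then have "ereal x \<le> ereal z" "ereal z \<le> ereal y"
    by auto
  then show "z \<in> sym_interval L"
    using assms unfolding sym_interval_def mem_Collect_eq by (meson order.strict_trans1 order.strict_trans2)
qed

locale velocity_law =
  fixes L :: ereal and F :: "real \<Rightarrow> real" and a b :: real
  assumes F_differentiable: "x \<in> sym_interval L \<Longrightarrow> F field_differentiable at x"
    and F_deriv_pos: "x \<in> sym_interval L \<Longrightarrow> 0 < deriv F x"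
    and a: "a \<in> sym_interval L" and b: "b \<in> sym_interval L" and a_less_b: "a < b"
begin

lemma DERIV_F: "x \<in> sym_interval L \<Longrightarrow> (F has_real_derivative deriv F x) (at x)"
  using F_differentiable by (rule field_differentiable_derivI)

lemma continuous_on_F: "continuous_on (sym_interval L) F"
  by (intro continuous_at_imp_continuous_on ballI DERIV_isCont[OF DERIV_F])

lemma F_less:
  assumes "x \<in> sym_interval L" "y \<in> sym_interval L" "x < y"
  shows "F x < F y"
proof (rule DERIV_pos_imp_increasing[OF assms(3)])
  fix z assume "x \<le> z" "z \<le> y"
  then have "z \<in> sym_interval L"
    using atLeastAtMost_subset_sym_interval[OF assms(1,2)] by auto
  then show "\<exists>d. (F has_real_derivative d) (at z) \<and> 0 < d"
    using DERIV_F F_deriv_pos by blast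
qed

lemma F_le_iff:
  assumes "x \<in> sym_interval L" "y \<in> sym_interval L"
  shows "F x \<le> F y \<longleftrightarrow> x \<le> y"
  using F_less[OF assms] F_less[OF assms(2,1)] by (cases x y rule: linorder_cases) auto

lemma inj_on_F: "inj_on F (sym_interval L)"
  by (rule inj_onI) (metis F_le_iff order.antisym order.refl)

lemma deriv_inverse_F:
  assumes "x \<in> sym_interval L"
  shows "deriv (the_inv_into (sym_interval L) F) (F x) = 1 / deriv F x"
proof -
  have "(the_inv_into (sym_interval L) F has_derivative (*) (inverse (deriv F x))) (at (F x))"
  proof (rule has_derivative_inverse_strong[OF open_sym_interval assms continuous_on_F])
    show "(F has_derivative (*) (deriv F x)) (at x)"
      using DERIV_F[OF assms] by (simp add: has_field_derivative_def)
    show "(*) (deriv F x) \<circ> (*) (inverse (deriv F x)) = id"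
      using F_deriv_pos[OF assms] by (auto simp: fun_eq_iff)
  qed (rule the_inv_into_f_f[OF inj_on_F])
  then show ?thesis
    by (simp add: has_field_derivative_def[symmetric] DERIV_imp_deriv inverse_eq_divide)
qed

lemma F_image_interval:
  assumes "y \<in> {F a..F b}"
  obtains x where "x \<in> {a..b}" "y = F x"
  using IVT'[of F a y b] assms a_less_b
    continuous_on_subset[OF continuous_on_F atLeastAtMost_subset_sym_interval[OF a b]]
  by auto

lemma deriv_inverse_F_pos:
  assumes "y \<in> {F a..F b}"
  shows "0 < deriv (the_inv_into (sym_interval L) F) y"
proof -
  obtain x where x: "x \<in> {a..b}" "y = F x"
    using F_image_interval[OF assms] by blast
  then have "x \<in> sym_interval L"
    using atLeastAtMost_subset_sym_interval[OF a b] by blast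
  with x show ?thesis
    by (simp add: deriv_inverse_F F_deriv_pos)
qed

lemma min_dG_nonneg: "0 \<le> min_dG L F a b"
  unfolding min_dG_def
proof (rule cINF_greatest)
  show "{F a..F b} \<noteq> {}"
    using F_less[OF a b a_less_b] by simp
qed (use deriv_inverse_F_pos in force)

lemma min_dG_le:
  assumes "x \<in> {a..b}"
  shows "min_dG L F a b \<le> 1 / deriv F x"
proof -
  have x: "x \<in> sym_interval L"
    using assms atLeastAtMost_subset_sym_interval[OF a b] by blast
  have "min_dG L F a b \<le> deriv (the_inv_into (sym_interval L) F) (F x)"
    unfolding min_dG_def
  proof (rule cINF_lower)
    show "bdd_below (deriv (the_inv_into (sym_interval L) F) ` {F a..F b})"
      using deriv_inverse_F_pos by (intro bdd_belowI2[where m = 0]) force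
    show "F x \<in> {F a..F b}"
      using assms F_le_iff a b x by auto
  qed
  with x show ?thesis
    by (simp add: deriv_inverse_F)
qed

text \<open>By the mean value theorem for \<open>F\<close>, since \<open>min_dG\<close> bounds \<open>1 / F'\<close> from below on \<open>[a, b]\<close>.\<close>

lemma velocity_gap:
  assumes p: "p \<in> {a..b}" and q: "q \<in> {a..b}" and c: "0 \<le> c" "F p - F q \<le> - c"
  shows "p - q \<le> - (min_dG L F a b * c)"
proof -
  have S: "{a..b} \<subseteq> sym_interval L"
    by (rule atLeastAtMost_subset_sym_interval[OF a b])
  have "p \<le> q"
    using F_le_iff[of p q] subsetD[OF S p] subsetD[OF S q] c by auto
  show ?thesis
  proof (cases "p = q")
    case True
    then show ?thesis using c by simp
  next
    case False
    with \<open>p \<le> q\<close> have "p < q" by simp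
    then obtain z where z: "p < z" "z < q" "F q - F p = (q - p) * deriv F z"
      using MVT2[of p q F "deriv F"] DERIV_F p q S by (meson atLeastAtMost_iff order_trans subsetD)
    have zab: "z \<in> {a..b}"
      using z p q by auto
    then have pos: "0 < deriv F z"
      using F_deriv_pos S by blast
    have "min_dG L F a b * c \<le> 1 / deriv F z * (F q - F p)"
      using min_dG_le[OF zab] c pos by (intro mult_mono) auto
    also have "\<dots> = q - p"
      using z(3) pos by simp
    finally show ?thesis by simp
  qed
qed

end

section \<open>The Kuramoto forcing\<close>

text \<open>The bounds \<open>c \<le> \<phi> \<le> \<beta>\<close> have separate purposes: \<open>\<beta>\<close> keeps the argument of \<open>F\<^sup>-\<^sup>1\<close> inside
  \<open>[F a, F b]\<close>, and \<open>c\<close> is the guaranteed strength of attraction. The condition \<open>coupling\<close> says that at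
  oscillation \<open>\<alpha>\<close> this attraction beats the spread of the natural frequencies.\<close>

locale kuramoto = velocity_law L F a b
  for L :: ereal and F :: "real \<Rightarrow> real" and a b :: real +
  fixes D :: "'a::euclidean_space set" and \<nu> :: "'a \<Rightarrow> real" and \<kappa> :: real
    and \<phi> :: "'a \<Rightarrow> 'a \<Rightarrow> real" and \<beta> c \<alpha> :: real
  assumes compact_D: "compact D" and measure_D: "0 < measure lebesgue D"
    and full_support: "x \<in> D \<Longrightarrow> 0 < e \<Longrightarrow> D \<inter> ball x e \<notin> null_sets lebesgue"
    and kappa_pos: "0 < \<kappa>"
    and continuous_nu: "continuous_on D \<nu>"
    and continuous_phi: "continuous_on (D \<times> D) (\<lambda>(x, y). \<phi> x y)"
    and phi_le: "x \<in> D \<Longrightarrow> y \<in> D \<Longrightarrow> \<phi> x y \<le> \<beta>"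
    and phi_ge: "x \<in> D \<Longrightarrow> y \<in> D \<Longrightarrow> c \<le> \<phi> x y"
    and c_pos: "0 < c"
    and nu_range: "x \<in> D \<Longrightarrow> F a + \<kappa> * \<beta> \<le> \<nu> x \<and> \<nu> x \<le> F b - \<kappa> * \<beta>"
    and \<alpha>: "0 < \<alpha>" "\<alpha> < pi / 2"
    and coupling: "osc D \<nu> < \<kappa> * (c * sin \<alpha>)"
begin

definition forcing :: "('a \<Rightarrow> real) \<Rightarrow> 'a \<Rightarrow> real" where
  "forcing f x = \<nu> x + \<kappa> / measure lebesgue D * (LINT z:D|lebesgue. \<phi> x z * sin (f z - f x))"

lemma D_nonempty: "D \<noteq> {}"
  using measure_D by auto

lemma continuous_on_phi_section: "x \<in> D \<Longrightarrow> continuous_on D (\<phi> x)"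
  using continuous_on_compose2[OF continuous_phi, of D "\<lambda>z. (x, z)"]
  by (force intro!: continuous_intros)

lemma continuous_on_forcing:
  assumes "continuous_on D f"
  shows "continuous_on D (forcing f)"
proof -
  have "continuous_on (D \<times> D) (\<lambda>p. f (fst p))" "continuous_on (D \<times> D) (\<lambda>p. f (snd p))"
    by (rule continuous_on_compose2[OF assms]; force intro!: continuous_intros)+
  then have "continuous_on (D \<times> D) (\<lambda>(x, z). \<phi> x z * sin (f z - f x))"
    using continuous_phi unfolding case_prod_beta by (intro continuous_intros)
  then show ?thesis
    unfolding forcing_def[abs_def]
    by (intro continuous_intros continuous_nu continuous_on_parametric_integral compact_D)
qed

lemma forcing_range:
  assumes f: "continuous_on D f" and x: "x \<in> D"
  shows "forcing f x \<in> {F a..F b}"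
proof -
  have "\<bar>LINT z:D|lebesgue. \<phi> x z * sin (f z - f x)\<bar> \<le> \<beta> * measure lebesgue D"
  proof (rule abs_set_integral_le[OF compact_D])
    show "continuous_on D (\<lambda>z. \<phi> x z * sin (f z - f x))"
      by (intro continuous_intros continuous_on_phi_section f x)
    show "\<bar>\<phi> x z * sin (f z - f x)\<bar> \<le> \<beta>" if "z \<in> D" for z
    proof -
      have "0 \<le> \<phi> x z" "\<phi> x z \<le> \<beta>"
        using phi_ge[OF x that] phi_le[OF x that] c_pos by auto
      then have "\<bar>\<phi> x z\<bar> * \<bar>sin (f z - f x)\<bar> \<le> \<beta> * 1"
        by (intro mult_mono) auto
      then show ?thesis by (simp add: abs_mult)
    qed
  qed
  then have "\<kappa> / measure lebesgue D * \<bar>LINT z:D|lebesgue. \<phi> x z * sin (f z - f x)\<bar>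
      \<le> \<kappa> / measure lebesgue D * (\<beta> * measure lebesgue D)"
    using kappa_pos measure_D by (intro mult_left_mono) auto
  also have "\<dots> = \<kappa> * \<beta>"
    using measure_D by simp
  finally have "\<bar>\<kappa> / measure lebesgue D * (LINT z:D|lebesgue. \<phi> x z * sin (f z - f x))\<bar> \<le> \<kappa> * \<beta>"
    using kappa_pos by (simp add: abs_mult)
  then show ?thesis
    using nu_range[OF x] unfolding forcing_def atLeastAtMost_iff by linarith
qed

text \<open>The velocities lie in \<open>[a, b]\<close> almost everywhere because \<open>forcing_range\<close> bounds their image under
  \<open>F\<close>. By full support they lie there everywhere, which makes \<open>F (\<theta>' t x)\<close> continuous in \<open>x\<close>,
  so that the equation extends to all of \<open>D\<close> in the same way.\<close>

lemma classical_solution_everywhere: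
  assumes sol: "classical_solution_CD L F D \<nu> \<kappa> \<phi> \<theta>0 \<theta>" and \<theta>0: "continuous_on D \<theta>0"
  obtains \<theta>' where "C1_into_CD D \<theta> \<theta>'"
    and "\<And>t x. 0 \<le> t \<Longrightarrow> x \<in> D \<Longrightarrow> \<theta>' t x \<in> {a..b} \<and> F (\<theta>' t x) = forcing (\<theta> t) x"
    and "\<And>x. x \<in> D \<Longrightarrow> \<theta> 0 x = \<theta>0 x"
proof -
  obtain \<theta>' where C1: "C1_into_CD D \<theta> \<theta>'"
    and eq: "\<And>t. 0 \<le> t \<Longrightarrow> AE x in lebesgue. x \<in> D \<longrightarrow>
      \<theta>' t x \<in> sym_interval L \<and> F (\<theta>' t x) = forcing (\<theta> t) x"
    and init: "AE x in lebesgue. x \<in> D \<longrightarrow> \<theta> 0 x = \<theta>0 x"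
    using sol unfolding classical_solution_CD_def forcing_def by blast
  have cont: "continuous_on D (\<theta> t)" "continuous_on D (\<theta>' t)" if "0 \<le> t" for t
    using C1 that by (auto simp: C1_into_CD_def)
  have range: "\<theta>' t x \<in> {a..b}" if t: "0 \<le> t" and x: "x \<in> D" for t x
  proof (rule AE_closed_imp_all[OF full_support cont(2)[OF t] closed_atLeastAtMost _ x])
    show "AE x in lebesgue. x \<in> D \<longrightarrow> \<theta>' t x \<in> {a..b}"
      using eq[OF t]
    proof eventually_elim
      case (elim x)
      show ?case
      proof
        assume x: "x \<in> D"
        show "\<theta>' t x \<in> {a..b}"
          using elim x forcing_range[OF cont(1)[OF t] x] F_le_iff[OF a, of "\<theta>' t x"]
            F_le_iff[OF _ b, of "\<theta>' t x"] by auto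
      qed
    qed
  qed
  have "F (\<theta>' t x) = forcing (\<theta> t) x" if t: "0 \<le> t" and x: "x \<in> D" for t x
  proof -
    have "continuous_on D (\<lambda>x. F (\<theta>' t x))"
      using atLeastAtMost_subset_sym_interval[OF a b] range[OF t]
      by (intro continuous_on_compose2[OF continuous_on_F cont(2)[OF t]]) blast
    then have "continuous_on D (\<lambda>x. F (\<theta>' t x) - forcing (\<theta> t) x)"
      by (intro continuous_intros continuous_on_forcing cont t)
    moreover have "AE x in lebesgue. x \<in> D \<longrightarrow> F (\<theta>' t x) - forcing (\<theta> t) x \<in> {0}"
      using eq[OF t] by eventually_elim auto
    ultimately have "F (\<theta>' t x) - forcing (\<theta> t) x \<in> {0}"
      by (intro AE_closed_imp_all[where f = "\<lambda>x. F (\<theta>' t x) - forcing (\<theta> t) x", OF full_support]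
          closed_singleton x)
    then show ?thesis by simp
  qed
  moreover have "\<theta> 0 x = \<theta>0 x" if x: "x \<in> D" for x
  proof -
    have "continuous_on D (\<lambda>x. \<theta> 0 x - \<theta>0 x)"
      by (intro continuous_intros cont \<theta>0) simp
    moreover have "AE x in lebesgue. x \<in> D \<longrightarrow> \<theta> 0 x - \<theta>0 x \<in> {0}"
      using init by eventually_elim auto
    ultimately have "\<theta> 0 x - \<theta>0 x \<in> {0}"
      by (intro AE_closed_imp_all[where f = "\<lambda>x. \<theta> 0 x - \<theta>0 x", OF full_support]
          closed_singleton x)
    then show ?thesis by simp
  qed
  ultimately show thesis
    using that C1 range by blast
qed

text \<open>Every other phase lies between the extreme ones \<open>f y\<close> and \<open>f x\<close>, so it pulls them together with
  strength \<open>c (sin A + sin B)\<close>, where \<open>A + B = \<alpha>\<close> splits the gap. Subadditivity of the sine makes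
  this at least \<open>c sin \<alpha>\<close>, wherever the phase lies.\<close>

lemma forcing_extremal_decrease:
  assumes f: "continuous_on D f" and x: "x \<in> D" and y: "y \<in> D"
    and gap: "f x - f y = \<alpha>" and spread: "\<And>u v. u \<in> D \<Longrightarrow> v \<in> D \<Longrightarrow> f u - f v \<le> \<alpha>"
  shows "forcing f x < forcing f y"
proof -
  let ?I = "\<lambda>x. LINT z:D|lebesgue. \<phi> x z * sin (f z - f x)"
  have int: "set_integrable lebesgue D (\<lambda>z. \<phi> u z * sin (f z - f u))" if "u \<in> D" for u
    by (intro set_integrable_compact compact_D continuous_intros continuous_on_phi_section f that)
  have "?I x - ?I y = (LINT z:D|lebesgue. \<phi> x z * sin (f z - f x) - \<phi> y z * sin (f z - f y))"
    by (simp add: set_integral_diff int x y)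
  also have "\<dots> \<le> (LINT z:D|lebesgue. - (c * sin \<alpha>))"
  proof (rule set_integral_mono)
    fix z assume z: "z \<in> D"
    define A B where "A = f x - f z" and "B = f z - f y"
    have AB: "0 \<le> A" "A \<le> \<alpha>" "0 \<le> B" "B \<le> \<alpha>" "A + B = \<alpha>"
      using spread[OF x z] spread[OF z y] gap unfolding A_def B_def by auto
    have sA: "0 \<le> sin A" "0 \<le> sin B"
      using AB \<alpha> by (auto intro!: sin_ge_zero)
    have "sin \<alpha> = sin A * cos B + cos A * sin B"
      using AB(5) sin_add by metis
    also have "\<dots> \<le> sin A * 1 + 1 * sin B"
      using sA by (intro add_mono mult_left_mono mult_right_mono) auto
    finally have "c * sin \<alpha> \<le> c * sin A + c * sin B"
      using c_pos by (simp add: distrib_left[symmetric])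
    also have "\<dots> \<le> \<phi> x z * sin A + \<phi> y z * sin B"
      using sA phi_ge x y z by (intro add_mono mult_right_mono) auto
    finally show "\<phi> x z * sin (f z - f x) - \<phi> y z * sin (f z - f y) \<le> - (c * sin \<alpha>)"
      using sin_minus[of A] unfolding A_def B_def by simp
  qed (intro set_integral_diff int x y set_integrable_compact compact_D continuous_intros)+
  also have "\<dots> = - (c * sin \<alpha>) * measure lebesgue D"
    by (rule set_integral_const_compact[OF compact_D])
  finally have "\<kappa> / measure lebesgue D * (?I x - ?I y)
      \<le> \<kappa> / measure lebesgue D * (- (c * sin \<alpha>) * measure lebesgue D)"
    using kappa_pos measure_D by (intro mult_left_mono) auto
  then have "\<kappa> / measure lebesgue D * ?I x - \<kappa> / measure lebesgue D * ?I y \<le> - (\<kappa> * (c * sin \<alpha>))"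
    using measure_D by (simp add: right_diff_distrib)
  moreover have "\<nu> x - \<nu> y \<le> osc D \<nu>"
    by (intro diff_le_osc compact_D continuous_nu x y)
  ultimately show ?thesis
    using coupling unfolding forcing_def by linarith
qed

text \<open>The barrier principle on \<open>D \<times> D\<close>, with the phase gap of a pair of points against the constant \<open>\<alpha>\<close>.\<close>

lemma phase_cohesion:
  assumes C1: "C1_into_CD D \<theta> \<theta>'"
    and eq: "\<And>t x. 0 \<le> t \<Longrightarrow> x \<in> D \<Longrightarrow> \<theta>' t x \<in> {a..b} \<and> F (\<theta>' t x) = forcing (\<theta> t) x"
    and init: "osc D (\<theta> 0) < \<alpha>"
    and t: "0 \<le> t" and x: "x \<in> D" and y: "y \<in> D"
  shows "\<theta> t x - \<theta> t y < \<alpha>"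
proof -
  let ?v = "\<lambda>t p. \<theta> t (fst p) - \<theta> t (snd p) - \<alpha>"
  have cont: "continuous_on D (\<theta> t)" if "0 \<le> t" for t
    using C1 that by (auto simp: C1_into_CD_def)
  have "?v t (x, y) < 0"
  proof (rule barrier[where v = ?v and v' = "\<lambda>t p. \<theta>' t (fst p) - \<theta>' t (snd p)"
        and K = "D \<times> D"])
    show "compact (D \<times> D)" "(x, y) \<in> D \<times> D"
      using compact_D x y by (auto intro: compact_Times)
    have joint: "continuous_on ({0..} \<times> (D \<times> D)) (\<lambda>q. \<theta> (fst q) (g (snd q)))"
      if "continuous_on (D \<times> D) g" "g ` (D \<times> D) \<subseteq> D" for g
      using continuous_on_compose2[OF C1_into_CD_jointly_continuous[OF compact_D C1],
          of "{0..} \<times> (D \<times> D)" "\<lambda>q. (fst q, g (snd q))"] that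
      by (force intro!: continuous_intros continuous_on_compose2[OF that(1)])
    show "continuous_on ({0..} \<times> (D \<times> D)) (\<lambda>(t, p). ?v t p)"
      unfolding case_prod_beta by (intro continuous_intros joint) auto
    show "((\<lambda>s. ?v s p) has_real_derivative \<theta>' s (fst p) - \<theta>' s (snd p)) (at s within {0..})"
      if "0 \<le> s" "p \<in> D \<times> D" for s p
      using that by (auto intro!: derivative_eq_intros C1_into_CD_has_derivative[OF compact_D C1])
    show "?v 0 p < 0" if "p \<in> D \<times> D" for p
      using diff_le_osc[OF compact_D cont[of 0], of "fst p" "snd p"] init that by auto
    show "\<theta>' s (fst p) - \<theta>' s (snd p) < 0"
      if s: "0 < s" and p: "p \<in> D \<times> D" "?v s p = 0"
        and le: "\<And>q. q \<in> D \<times> D \<Longrightarrow> ?v s q \<le> 0" for s p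
    proof -
      have pD: "fst p \<in> D" "snd p \<in> D"
        using p by auto
      have "forcing (\<theta> s) (fst p) < forcing (\<theta> s) (snd p)"
      proof (rule forcing_extremal_decrease[OF cont pD])
        show "\<theta> s u - \<theta> s v \<le> \<alpha>" if "u \<in> D" "v \<in> D" for u v
          using le[of "(u, v)"] that by simp
      qed (use s p in auto)
      moreover have "0 \<le> s"
        using s by simp
      note v = eq[OF this pD(1)] eq[OF this pD(2)]
      ultimately have "\<not> F (\<theta>' s (snd p)) \<le> F (\<theta>' s (fst p))"
        by simp
      moreover have "\<theta>' s (fst p) \<in> sym_interval L" "\<theta>' s (snd p) \<in> sym_interval L"
        using v atLeastAtMost_subset_sym_interval[OF a b] by blast+
      ultimately show ?thesis
        by (simp add: F_le_iff)
    qed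
  qed (use t in auto)
  then show ?thesis by simp
qed

lemma L1_norm_le:
  assumes "continuous_on D f"
  shows "L1_norm D f \<le> measure lebesgue D * sup_norm D f"
proof -
  have "\<bar>LINT x:D|lebesgue. \<bar>f x\<bar>\<bar> \<le> sup_norm D f * measure lebesgue D"
    using assms abs_le_sup_norm[OF compact_D assms]
    by (intro abs_set_integral_le compact_D continuous_intros) auto
  then show ?thesis
    by (simp add: L1_norm_def mult.commute)
qed

lemma sin_double_pos: "0 < sin (2 * \<alpha>)"
  using \<alpha> by (intro sin_gt_zero) auto

lemma dissipation_nonneg:
  assumes "continuous_on D (\<theta> s)" "continuous_on D (\<eta> s)"
  shows "0 \<le> dissipation L F a b D \<kappa> c \<alpha> \<theta> \<eta> s"
proof -
  have "continuous_on D (\<lambda>x. \<theta> s x - \<eta> s x)"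
    by (intro continuous_intros assms)
  from L1_norm_le[OF this] show ?thesis
    using kappa_pos c_pos \<alpha> measure_D min_dG_nonneg sin_double_pos unfolding dissipation_def
    by (intro mult_nonneg_nonneg divide_nonneg_nonneg) auto
qed

lemma dissipation_commute: "dissipation L F a b D \<kappa> c \<alpha> \<theta> \<eta> s = dissipation L F a b D \<kappa> c \<alpha> \<eta> \<theta> s"
  unfolding dissipation_def sup_norm_def L1_norm_def by (simp add: abs_minus_commute)

text \<open>All phases satisfy \<open>w z \<le> \<bar>w z\<bar> \<le> w x\<close> for \<open>w = \<theta> - \<eta>\<close>. Replacing \<open>w z\<close> by \<open>\<bar>w z\<bar>\<close> in the secant
  bound is what produces the \<open>L\<^sup>1\<close> norm; since \<open>\<bar>w z\<bar> - w x\<close> is nonpositive, \<open>\<phi> x z\<close> may afterwards be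
  replaced by its lower bound.\<close>

lemma extremal_contraction:
  assumes cont: "continuous_on D (\<theta> s)" "continuous_on D (\<eta> s)"
    and cohesion: "\<And>x y. x \<in> D \<Longrightarrow> y \<in> D \<Longrightarrow> \<theta> s x - \<theta> s y \<le> \<alpha>"
      "\<And>x y. x \<in> D \<Longrightarrow> y \<in> D \<Longrightarrow> \<eta> s x - \<eta> s y \<le> \<alpha>"
    and x: "x \<in> D" and max: "\<And>z. z \<in> D \<Longrightarrow> \<bar>\<theta> s z - \<eta> s z\<bar> \<le> \<theta> s x - \<eta> s x"
    and p: "p \<in> {a..b}" "F p = forcing (\<theta> s) x" and q: "q \<in> {a..b}" "F q = forcing (\<eta> s) x"
  shows "p - q \<le> - dissipation L F a b D \<kappa> c \<alpha> \<theta> \<eta> s"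
proof -
  define w where "w = (\<lambda>z. \<theta> s z - \<eta> s z)"
  define r where "r = c * sin (2 * \<alpha>) / (2 * \<alpha>)"
  have cw: "continuous_on D w"
    unfolding w_def by (intro continuous_intros cont)
  have r: "0 \<le> r"
    using c_pos \<alpha> sin_double_pos by (simp add: r_def)
  have W: "sup_norm D w = w x"
  proof (rule antisym)
    show "sup_norm D w \<le> w x"
      using max by (intro sup_norm_le D_nonempty) (simp add: w_def)
    show "w x \<le> sup_norm D w"
      using abs_le_sup_norm[OF compact_D cw x] by linarith
  qed
  let ?I = "\<lambda>f. LINT z:D|lebesgue. \<phi> x z * sin (f z - f x)"
  have int: "set_integrable lebesgue D (\<lambda>z. \<phi> x z * sin (f z - f x))" if "continuous_on D f" for f
    by (intro set_integrable_compact compact_D continuous_intros continuous_on_phi_section that x)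
  have "?I (\<theta> s) - ?I (\<eta> s)
      = (LINT z:D|lebesgue. \<phi> x z * sin (\<theta> s z - \<theta> s x) - \<phi> x z * sin (\<eta> s z - \<eta> s x))"
    by (simp add: set_integral_diff int cont)
  also have "\<dots> \<le> (LINT z:D|lebesgue. r * (\<bar>w z\<bar> - w x))"
  proof (rule set_integral_mono)
    fix z assume z: "z \<in> D"
    have wz: "w z - w x \<le> \<bar>w z\<bar> - w x" "\<bar>w z\<bar> - w x \<le> 0"
      using max[OF z] by (auto simp: w_def)
    have "sin (\<theta> s z - \<theta> s x) - sin (\<eta> s z - \<eta> s x)
        \<le> sin (2 * \<alpha>) / (2 * \<alpha>) * ((\<theta> s z - \<theta> s x) - (\<eta> s z - \<eta> s x))"
      using cohesion(1)[OF x z] cohesion(1)[OF z x] cohesion(2)[OF x z] cohesion(2)[OF z x] wz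
      by (intro sin_diff_le_secant \<alpha>) (auto simp: w_def)
    also have "\<dots> \<le> sin (2 * \<alpha>) / (2 * \<alpha>) * (\<bar>w z\<bar> - w x)"
      using wz(1) sin_double_pos \<alpha> unfolding w_def by (intro mult_left_mono) auto
    finally have le: "sin (\<theta> s z - \<theta> s x) - sin (\<eta> s z - \<eta> s x)
        \<le> sin (2 * \<alpha>) / (2 * \<alpha>) * (\<bar>w z\<bar> - w x)" .
    have neg: "sin (2 * \<alpha>) / (2 * \<alpha>) * (\<bar>w z\<bar> - w x) \<le> 0"
      using wz(2) sin_double_pos \<alpha> by (intro mult_nonneg_nonpos) auto
    have "\<phi> x z * (sin (\<theta> s z - \<theta> s x) - sin (\<eta> s z - \<eta> s x))
        \<le> \<phi> x z * (sin (2 * \<alpha>) / (2 * \<alpha>) * (\<bar>w z\<bar> - w x))"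
      using le phi_ge[OF x z] c_pos by (intro mult_left_mono) auto
    also have "\<dots> \<le> c * (sin (2 * \<alpha>) / (2 * \<alpha>) * (\<bar>w z\<bar> - w x))"
      using neg phi_ge[OF x z] by (intro mult_right_mono_neg) auto
    finally show "\<phi> x z * sin (\<theta> s z - \<theta> s x) - \<phi> x z * sin (\<eta> s z - \<eta> s x) \<le> r * (\<bar>w z\<bar> - w x)"
      unfolding r_def by (simp add: right_diff_distrib)
  qed (intro set_integral_diff int cont set_integrable_compact compact_D continuous_intros cw)+
  also have "\<dots> = r * (L1_norm D w - measure lebesgue D * sup_norm D w)"
    using cw unfolding L1_norm_def W
    by (simp add: set_integral_diff set_integrable_compact compact_D continuous_on_rabs
        set_integral_const_compact mult.commute)
  finally have "\<kappa> / measure lebesgue D * (?I (\<theta> s) - ?I (\<eta> s))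
      \<le> \<kappa> / measure lebesgue D * (r * (L1_norm D w - measure lebesgue D * sup_norm D w))"
    using kappa_pos measure_D by (intro mult_left_mono) auto
  then have "F p - F q
      \<le> - (\<kappa> / measure lebesgue D * (r * (measure lebesgue D * sup_norm D w - L1_norm D w)))"
    unfolding p q forcing_def by (simp add: algebra_simps)
  moreover have "0 \<le> \<kappa> / measure lebesgue D * (r * (measure lebesgue D * sup_norm D w - L1_norm D w))"
    using L1_norm_le[OF cw] kappa_pos measure_D r by (intro mult_nonneg_nonneg) auto
  ultimately have "p - q \<le> - (min_dG L F a b *
      (\<kappa> / measure lebesgue D * (r * (measure lebesgue D * sup_norm D w - L1_norm D w))))"
    by (intro velocity_gap p(1) q(1))
  also have "\<dots> = - dissipation L F a b D \<kappa> c \<alpha> \<theta> \<eta> s"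
    unfolding dissipation_def r_def w_def by (simp add: mult_ac)
  finally show ?thesis .
qed

lemma continuous_on_dissipation:
  assumes C1: "C1_into_CD D \<theta> \<theta>'" "C1_into_CD D \<eta> \<eta>'"
  shows "continuous_on {0..} (dissipation L F a b D \<kappa> c \<alpha> \<theta> \<eta>)"
proof -
  let ?w = "\<lambda>s x. \<theta> s x - \<eta> s x"
  have cw: "continuous_on D (?w s)" if "0 \<le> s" for s
    using C1 that by (intro continuous_intros) (auto simp: C1_into_CD_def)
  have lim: "uniform_limit D ?w (?w s) (at s within {0..})" if "0 \<le> s" for s
    by (intro uniform_limit_minus C1_into_CD_uniform_limit[OF compact_D C1(1)]
        C1_into_CD_uniform_limit[OF compact_D C1(2)] that)
  have ev: "\<forall>\<^sub>F s in at t within {0..}. continuous_on D (?w s)" for t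
    using cw by (auto simp: eventually_at_filter)
  have "continuous_on {0..} (\<lambda>s. sup_norm D (?w s))"
    unfolding continuous_on_def using ev cw lim
    by (auto intro!: tendsto_sup_norm compact_D D_nonempty)
  moreover have "continuous_on {0..} (\<lambda>s. L1_norm D (?w s))"
    unfolding continuous_on_def using ev cw lim by (auto intro!: tendsto_L1_norm compact_D)
  ultimately show ?thesis
    unfolding dissipation_def[abs_def] by (intro continuous_intros)
qed

text \<open>The barrier principle for \<open>\<bar>w\<bar>\<close>, where \<open>w = \<theta> - \<eta>\<close>, against the claimed bound. A factor
  \<open>{-1, 1}\<close> in the index set stands for the sign of \<open>w\<close>: whichever sign is extremal, all of \<open>\<bar>w\<bar>\<close> is then
  below the barrier at a touching time, as \<open>extremal_contraction\<close> demands. A slack \<open>e (1 + t)\<close>,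
  removed at the end, makes the initial inequality and the one at touching strict.\<close>

lemma contraction:
  assumes C1: "C1_into_CD D \<theta> \<theta>'" "C1_into_CD D \<eta> \<eta>'"
    and eq_\<theta>: "\<And>t x. 0 \<le> t \<Longrightarrow> x \<in> D \<Longrightarrow> \<theta>' t x \<in> {a..b} \<and> F (\<theta>' t x) = forcing (\<theta> t) x"
    and eq_\<eta>: "\<And>t x. 0 \<le> t \<Longrightarrow> x \<in> D \<Longrightarrow> \<eta>' t x \<in> {a..b} \<and> F (\<eta>' t x) = forcing (\<eta> t) x"
    and cohesive: "osc D (\<theta> 0) < \<alpha>" "osc D (\<eta> 0) < \<alpha>"
    and t: "0 \<le> t"
  shows "sup_norm D (\<lambda>x. \<theta> t x - \<eta> t x) + integral {0..t} (dissipation L F a b D \<kappa> c \<alpha> \<theta> \<eta>)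
    \<le> sup_norm D (\<lambda>x. \<theta> 0 x - \<eta> 0 x)"
proof -
  let ?P = "dissipation L F a b D \<kappa> c \<alpha> \<theta> \<eta>"
  define W0 where "W0 = sup_norm D (\<lambda>x. \<theta> 0 x - \<eta> 0 x)"
  have cont: "continuous_on D (\<theta> s)" "continuous_on D (\<eta> s)" if "0 \<le> s" for s
    using C1 that by (auto simp: C1_into_CD_def)
  have coh: "\<theta> s x - \<theta> s y \<le> \<alpha>" "\<eta> s x - \<eta> s y \<le> \<alpha>" if "0 \<le> s" "x \<in> D" "y \<in> D" for s x y
    using phase_cohesion[OF C1(1) eq_\<theta> cohesive(1) that]
      phase_cohesion[OF C1(2) eq_\<eta> cohesive(2) that] by simp_all
  have dint: "((\<lambda>u. integral {0..u} ?P) has_real_derivative ?P s) (at s within {0..})"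
    if "0 \<le> s" for s
  proof -
    have "((\<lambda>u. integral {0..u} ?P) has_real_derivative ?P s) (at s within {0..s + 1})"
      using continuous_on_subset[OF continuous_on_dissipation[OF C1], of "{0..s + 1}"] that
      by (intro integral_has_real_derivative) auto
    moreover have "at s within {0..s + 1} = at s within {0..}"
      by (rule at_within_nhd[of _ "{..<s + 1}"]) auto
    ultimately show ?thesis by simp
  qed
  have bound: "sup_norm D (\<lambda>x. \<theta> t x - \<eta> t x) \<le> W0 + e * (1 + t) - integral {0..t} ?P"
    if e: "0 < e" for e
  proof -
    define h where "h = (\<lambda>s. W0 + e * (1 + s) - integral {0..s} ?P)"
    have dh: "(h has_real_derivative e - ?P s) (at s within {0..})" if "0 \<le> s" for s
      unfolding h_def by (auto intro!: derivative_eq_intros dint that)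
    let ?K = "{-1, 1 :: real} \<times> D"
    let ?v = "\<lambda>s q. fst q * (\<theta> s (snd q) - \<eta> s (snd q)) - h s"
    let ?v' = "\<lambda>s q. fst q * (\<theta>' s (snd q) - \<eta>' s (snd q)) - (e - ?P s)"
    have below: "?v t q < 0" if q: "q \<in> ?K" for q
    proof (rule barrier[where v = ?v and v' = ?v' and K = ?K, OF _ _ _ _ _ t q])
      show "compact ?K"
        by (intro compact_Times compact_D finite_imp_compact) simp
      have joint: "continuous_on ({0..} \<times> ?K) (\<lambda>q. f (fst q) (snd (snd q)))"
        if "continuous_on ({0..} \<times> D) (\<lambda>(t, x). f t x)" for f :: "real \<Rightarrow> 'a \<Rightarrow> real"
        using continuous_on_compose2[OF that, of "{0..} \<times> ?K" "\<lambda>q. (fst q, snd (snd q))"]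
        by (force intro!: continuous_intros)
      have "continuous_on {0..} h"
        using dh by (intro DERIV_continuous_on) auto
      then have "continuous_on ({0..} \<times> ?K) (\<lambda>q. h (fst q))"
        by (rule continuous_on_compose2) (auto intro!: continuous_intros)
      then show "continuous_on ({0..} \<times> ?K) (\<lambda>(s, q). ?v s q)"
        using joint[OF C1_into_CD_jointly_continuous[OF compact_D C1(1)]]
          joint[OF C1_into_CD_jointly_continuous[OF compact_D C1(2)]]
        unfolding case_prod_beta by (intro continuous_intros)
      show "((\<lambda>s. ?v s q) has_real_derivative ?v' s q) (at s within {0..})"
        if "0 \<le> s" "q \<in> ?K" for s q
        using that by (auto intro!: derivative_eq_intros dh
            C1_into_CD_has_derivative[OF compact_D C1(1)]
            C1_into_CD_has_derivative[OF compact_D C1(2)])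
      show "?v 0 q < 0" if "q \<in> ?K" for q
      proof -
        have "\<bar>\<theta> 0 (snd q) - \<eta> 0 (snd q)\<bar> \<le> W0"
          unfolding W0_def using that cont[of 0]
          by (intro abs_le_sup_norm[where f = "\<lambda>x. \<theta> 0 x - \<eta> 0 x"] compact_D continuous_intros) auto
        then show ?thesis
          using that e by (auto simp: h_def)
      qed
      show "?v' s q < 0"
        if s: "0 < s" and q: "q \<in> ?K" "?v s q = 0"
          and le: "\<And>p. p \<in> ?K \<Longrightarrow> ?v s p \<le> 0" for s q
      proof -
        obtain \<sigma> x where qx: "q = (\<sigma>, x)" "x \<in> D" "\<sigma> = 1 \<or> \<sigma> = -1"
          using q(1) by auto
        have s0: "0 \<le> s"
          using s by simp
        \<comment> \<open>both signs are below the barrier, so \<open>h s\<close> is the supremum norm\<close>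
        have max: "\<bar>\<theta> s z - \<eta> s z\<bar> \<le> h s" if "z \<in> D" for z
          using le[of "(1, z)"] le[of "(-1, z)"] that by auto
        note e\<theta> = eq_\<theta>[OF s0 qx(2)] and e\<eta> = eq_\<eta>[OF s0 qx(2)]
        have "\<sigma> * (\<theta>' s x - \<eta>' s x) \<le> - ?P s"
          using qx(3)
        proof
          assume \<sigma>: "\<sigma> = 1"
          have "\<theta>' s x - \<eta>' s x \<le> - ?P s"
            using max q(2) e\<theta> e\<eta> qx \<sigma> s0
            by (intro extremal_contraction[of \<theta> s \<eta> x] cont coh) auto
          then show ?thesis using \<sigma> by simp
        next
          assume \<sigma>: "\<sigma> = -1"
          have "\<eta>' s x - \<theta>' s x \<le> - dissipation L F a b D \<kappa> c \<alpha> \<eta> \<theta> s"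
            using max q(2) e\<theta> e\<eta> qx \<sigma> s0
            by (intro extremal_contraction[of \<eta> s \<theta> x] cont coh) (auto simp: abs_minus_commute)
          then show ?thesis using \<sigma> dissipation_commute[of \<theta> \<eta> s] by simp
        qed
        then show ?thesis
          using e qx(1) by simp
      qed
    qed
    have "sup_norm D (\<lambda>x. \<theta> t x - \<eta> t x) \<le> h t"
    proof (rule sup_norm_le[OF D_nonempty])
      show "\<bar>\<theta> t x - \<eta> t x\<bar> \<le> h t" if "x \<in> D" for x
        using below[of "(1, x)"] below[of "(-1, x)"] that by auto
    qed
    then show ?thesis by (simp add: h_def)
  qed
  have "sup_norm D (\<lambda>x. \<theta> t x - \<eta> t x) \<le> W0 - integral {0..t} ?P"
  proof (rule field_le_epsilon)
    fix e :: real assume "0 < e"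
    then show "sup_norm D (\<lambda>x. \<theta> t x - \<eta> t x) \<le> W0 - integral {0..t} ?P + e"
      using bound[of "e / (1 + t)"] t by simp
  qed
  then show ?thesis
    by (simp add: W0_def)
qed

end

theorem proposition4p2:
  fixes L :: ereal and F :: "real \<Rightarrow> real"
    and D :: "'a::euclidean_space set" and P :: "nat \<Rightarrow> nat \<Rightarrow> 'a set"
    and \<kappa> :: real and \<nu> \<theta>0 \<eta>0 :: "'a \<Rightarrow> real" and \<phi> :: "'a \<Rightarrow> 'a \<Rightarrow> real"
    and a\<Phi> b\<Phi> aG bG \<theta>bar a\<phi> \<theta>s :: real
    and \<theta> \<eta> :: "real \<Rightarrow> 'a \<Rightarrow> real"
  assumes L: "0 < L"
    and F_C2: "C2_on F (sym_interval L)"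
    and F_odd: "\<And>x. x \<in> sym_interval L \<Longrightarrow> F (- x) = - F x"
    and F_deriv: "\<And>x. x \<in> sym_interval L \<Longrightarrow> 0 < deriv F x"
    and D: "compact D" "0 < measure lebesgue D"
    and kappa: "0 < \<kappa>"
    and phi_pos: "\<And>x y. x \<in> D \<Longrightarrow> y \<in> D \<Longrightarrow> 0 < \<phi> x y"
    and B1: "dyadic_partitions D P"
    and B2: "continuous_on D \<nu>" "continuous_on (D \<times> D) (\<lambda>(x, y). \<phi> x y)" "continuous_on D \<theta>0"
    and B3_const: "0 < a\<Phi>" "a\<Phi> \<le> b\<Phi>"
      "aG \<in> sym_interval L" "bG \<in> sym_interval L" "aG < bG" "0 < \<theta>bar" "\<theta>bar < pi / 2"
    and B3_osc: "osc D \<theta>0 \<le> \<theta>bar"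
    and B3_phi: "\<And>x y. x \<in> D \<Longrightarrow> y \<in> D \<Longrightarrow> a\<Phi> \<le> \<phi> x y \<and> \<phi> x y \<le> b\<Phi>"
    and B3_kappa: "\<kappa> > max (osc D \<nu> / (a\<Phi> * sin \<theta>bar))
        (2 * max_inv_quotient F aG bG / (a\<Phi> * (min_dG L F aG bG)\<^sup>2 * cos \<theta>bar))"
    and B3_nu: "\<And>x. x \<in> D \<Longrightarrow> F aG + \<kappa> * b\<Phi> \<le> \<nu> x \<and> \<nu> x \<le> F bG - \<kappa> * b\<Phi>"
    and eta0: "continuous_on D \<eta>0"
    and const: "0 < a\<phi>" "0 < \<theta>s" "\<theta>s < pi / 2"
    and phi_ge: "\<And>x y. x \<in> D \<Longrightarrow> y \<in> D \<Longrightarrow> a\<phi> \<le> \<phi> x y"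
    and osc_init: "0 < osc D \<theta>0" "osc D \<theta>0 < \<theta>s" "0 < osc D \<eta>0" "osc D \<eta>0 < \<theta>s"
    and kappa_gt: "\<kappa> > osc D \<nu> / (a\<phi> * sin \<theta>s)"
    and init_close: "sup_norm D (\<lambda>x. \<theta>0 x - \<eta>0 x) < pi"
    and sol_theta: "classical_solution_CD L F D \<nu> \<kappa> \<phi> \<theta>0 \<theta>"
    and sol_eta: "classical_solution_CD L F D \<nu> \<kappa> \<phi> \<eta>0 \<eta>"
  shows "(\<forall>s\<ge>0. 0 \<le> dissipation L F aG bG D \<kappa> a\<phi> \<theta>s \<theta> \<eta> s) \<and>
    (\<forall>t\<ge>0. sup_norm D (\<lambda>x. \<theta> t x - \<eta> t x)
        + (LINT s:{0..t}|lebesgue. dissipation L F aG bG D \<kappa> a\<phi> \<theta>s \<theta> \<eta> s)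
      \<le> sup_norm D (\<lambda>x. \<theta>0 x - \<eta>0 x))"
proof -
  have "F field_differentiable at x" if "x \<in> sym_interval L" for x
    using F_C2 that by (auto simp: C2_on_def)
  moreover have "osc D \<nu> < \<kappa> * (a\<phi> * sin \<theta>s)"
    using kappa_gt const by (simp add: pos_divide_less_eq sin_gt_zero2 mult_ac)
  ultimately interpret kuramoto L F aG bG D \<nu> \<kappa> \<phi> b\<Phi> a\<phi> \<theta>s
    using F_deriv B3_const D dyadic_ball_not_null[OF D B1] kappa B2 B3_phi phi_ge const B3_nu
    by unfold_locales auto
  obtain \<theta>' where \<theta>: "C1_into_CD D \<theta> \<theta>'"
    "\<And>t x. 0 \<le> t \<Longrightarrow> x \<in> D \<Longrightarrow> \<theta>' t x \<in> {aG..bG} \<and> F (\<theta>' t x) = forcing (\<theta> t) x"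
    "\<And>x. x \<in> D \<Longrightarrow> \<theta> 0 x = \<theta>0 x"
    using classical_solution_everywhere[OF sol_theta B2(3)] by metis
  obtain \<eta>' where \<eta>: "C1_into_CD D \<eta> \<eta>'"
    "\<And>t x. 0 \<le> t \<Longrightarrow> x \<in> D \<Longrightarrow> \<eta>' t x \<in> {aG..bG} \<and> F (\<eta>' t x) = forcing (\<eta> t) x"
    "\<And>x. x \<in> D \<Longrightarrow> \<eta> 0 x = \<eta>0 x"
    using classical_solution_everywhere[OF sol_eta eta0] by metis
  have init: "osc D (\<theta> 0) < \<theta>s" "osc D (\<eta> 0) < \<theta>s"
      "sup_norm D (\<lambda>x. \<theta> 0 x - \<eta> 0 x) = sup_norm D (\<lambda>x. \<theta>0 x - \<eta>0 x)"
    using osc_init \<theta>(3) \<eta>(3) by (simp_all add: osc_def sup_norm_def)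
  let ?P = "dissipation L F aG bG D \<kappa> a\<phi> \<theta>s \<theta> \<eta>"
  have "(LINT s:{0..t}|lebesgue. ?P s) = integral {0..t} ?P" for t
    by (intro set_lebesgue_integral_eq_integral set_integrable_compact compact_Icc
        continuous_on_subset[OF continuous_on_dissipation[OF \<theta>(1) \<eta>(1)]]) auto
  then show ?thesis
    using contraction[OF \<theta>(1) \<eta>(1) \<theta>(2) \<eta>(2) init(1,2)] init(3) dissipation_nonneg \<theta>(1) \<eta>(1)
    by (simp add: C1_into_CD_def)
qed

end
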